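(* Let $K$ be an infinite field, $R=K[x,y,z]$, and $I=(x^a,y^b,z^c,x^\alpha y^\beta z^\gamma)$, where $0\le\alpha<a$, $0\le\beta<b$, $0\le\gamma<c$ are integers and at most one of $\alpha,\beta,\gamma$ is zero. Suppose $a+b+c+\alpha+\beta+\gamma\equiv 0\pmod 3$, put $s=\frac13(a+b+c+\alpha+\beta+\gamma)-2$, $A=s+2-a$, $B=s+2-b$, $C=s+2-c$, $M=s+2-(\alpha+\beta+\gamma)$, and assume $0\le M$, $0\le A\le\beta+\gamma$, $0\le B\le\alpha+\gamma$, $0\le C\le\alpha+\beta$. Let $h_s=\dim_K[R/I]_s$. Then there exists a matrix $Z=Z_{a,b,c,\alpha,\beta,\gamma}$ such that: (i) $Z$ is a square integer matrix of size $h_s$; (ii) $R/I$ has the weak Lefschetz property if and only if $\det Z\not\equiv0\pmod{\operatorname{char}K}$; (iii) the entries of $Z$ are given by $(Z)_{i,j}=1$ if $n_j$ is a multiple of $m_i$ and $(Z)_{i,j}=0$ otherwise, where $\{m_1,\dots,m_{h_s}\}$ and $\{n_1,\dots,n_{h_s}\}$ are the monomial bases of $[R/I]_s$ and $[R/I]_{s+1}$, respectively, given in lexicographic order.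
   Context: $R$ is standard graded; the monomial basis of $[R/I]_d$ is the set of monomials of degree $d$ not in $I$. When $\operatorname{char}K=0$, "$\det Z\not\equiv0\pmod{\operatorname{char} K}$" means $\det Z\ne0$. An artinian standard graded $K$-algebra $Q$ has the weak Lefschetz property if there is a linear form $\ell\in[Q]_1$ such that for all integers $d$ the map $\times\ell:[Q]_d\to[Q]_{d+1}$ is injective or surjective. *)

theory Defs
  imports
    "HOL-Library.Poly_Mapping"
    "HOL-Library.Numeral_Type"
    "HOL-Number_Theory.Cong"
    "HOL-Algebra.QuotRing"
    "HOL-Algebra.Embedded_Algebras"
    "HOL-Algebra.Algebraic_Closure_Type"
    "Jordan_Normal_Form.Determinant"
begin

section \<open>The polynomial ring \<open>K[x,y,z]\<close> and its homogeneous parts\<close>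

text \<open>
  The three variables \<open>x\<close>, \<open>y\<close>, \<open>z\<close> are indexed by the elements \<open>0 < 1 < 2\<close> of the three-element
  type \<open>3\<close>. A monomial is given by its exponent function \<open>3 \<Rightarrow>\<^sub>0 nat\<close>, a polynomial by its
  coefficient function on monomials.
\<close>

type_synonym 'k poly3 = "(3 \<Rightarrow>\<^sub>0 nat) \<Rightarrow>\<^sub>0 'k"

definition indet :: "3 \<Rightarrow> 'k::field poly3" where
  "indet i = Poly_Mapping.single (Poly_Mapping.single i 1) 1"

definition mon :: "(3 \<Rightarrow>\<^sub>0 nat) \<Rightarrow> 'k::field poly3" where
  "mon m = Poly_Mapping.single m 1"

definition const_poly :: "'k::field \<Rightarrow> 'k poly3" where
  "const_poly c = Poly_Mapping.single 0 c"

definition mon_degree :: "(3 \<Rightarrow>\<^sub>0 nat) \<Rightarrow> nat" where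
  "mon_degree m = (\<Sum>i\<in>UNIV. Poly_Mapping.lookup m i)"

text \<open>Degrees range over the integers; the parts of negative degree are zero.\<close>

definition homogeneous :: "int \<Rightarrow> 'k::field poly3 set" where
  "homogeneous d = {f. \<forall>m\<in>Poly_Mapping.keys f. int (mon_degree m) = d}"

abbreviation poly3_ring :: "'k::field poly3 ring" where
  "poly3_ring \<equiv> ring_of_type_algebra"


section \<open>The graded algebra \<open>R/I\<close>\<close>

definition quot_ring :: "'k::field poly3 set \<Rightarrow> 'k poly3 set ring" where
  "quot_ring I = poly3_ring Quot I"

definition quot_part :: "'k::field poly3 set \<Rightarrow> int \<Rightarrow> 'k poly3 set set" where
  "quot_part I d = (\<lambda>f. I +>\<^bsub>poly3_ring\<^esub> f) ` homogeneous d"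

text \<open>The copy of the field \<open>K\<close> inside \<open>R/I\<close>, over which dimensions are taken.\<close>

definition quot_scalars :: "'k::field poly3 set \<Rightarrow> 'k poly3 set set" where
  "quot_scalars I = range (\<lambda>c. I +>\<^bsub>poly3_ring\<^esub> const_poly c)"

definition hilbert_function :: "'k::field poly3 set \<Rightarrow> int \<Rightarrow> nat" where
  "hilbert_function I d = ring.dim (quot_ring I) (quot_scalars I) (quot_part I d)"

text \<open>The argument \<open>G\<close> is the grading of the algebra \<open>Q\<close>: \<open>G d\<close> is the part of degree \<open>d\<close>.\<close>

definition weak_Lefschetz :: "('a, 'b) ring_scheme \<Rightarrow> (int \<Rightarrow> 'a set) \<Rightarrow> bool" where
  "weak_Lefschetz Q G \<longleftrightarrow>
     (\<exists>l\<in>G 1. \<forall>d. inj_on (\<lambda>q. l \<otimes>\<^bsub>Q\<^esub> q) (G d) \<or> (\<lambda>q. l \<otimes>\<^bsub>Q\<^esub> q) ` G d = G (d + 1))"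

text \<open>
  The order on \<open>3 \<Rightarrow>\<^sub>0 nat\<close> compares two exponent functions at the smallest index at which they
  differ, so it is the lexicographic monomial order with \<open>x > y > z\<close>. The list starts with the
  largest monomial, as in \<open>x^2, xy, xz, y^2, yz, z^2\<close>.
\<close>

definition monomial_basis :: "'k::field poly3 set \<Rightarrow> int \<Rightarrow> 'k poly3 list" where
  "monomial_basis I d =
     map mon (rev (sorted_list_of_set {m. int (mon_degree m) = d \<and> (mon m :: 'k poly3) \<notin> I}))"

end

theory Submission
  imports Defs
begin

text \<open>
  Three observations reduce the theorem to one square matrix.

  The monomials outside \<open>I\<close>, called standard here, form bases of the graded parts of \<open>R/I\<close>. In degrees
  up to \<open>s + 1\<close> no monomial is a multiple of two of the four generators, so standard monomials are
  counted without overlaps. From degree \<open>s\<close> to \<open>s + 1\<close> the number of all monomials grows by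
  \<open>s + 2\<close>, and the numbers of multiples of the generators grow by \<open>A\<close>, \<open>B\<close>, \<open>C\<close> and \<open>M\<close>
  (lemma \<open>card_standard_Suc\<close>). Since \<open>A + B + C + M = s + 2\<close>, the two graded parts have equal
  dimension, and multiplication between them is given by a square matrix.

  Let \<open>l = l\<^sub>0 x + l\<^sub>1 y + l\<^sub>2 z\<close> be any linear form. The entry of the matrix of \<open>\<times>l\<close> at standard
  monomials \<open>m\<close> and \<open>n\<close> is the value of the variable \<open>n/m\<close> at \<open>(l\<^sub>0, l\<^sub>1, l\<^sub>2)\<close> if \<open>m\<close> divides
  \<open>n\<close>, and zero otherwise. Each nonzero term of the Leibniz expansion therefore carries the same
  monomial in \<open>l\<^sub>0, l\<^sub>1, l\<^sub>2\<close>, namely the product of all \<open>n\<close> divided by the product of all \<open>m\<close>. So the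
  determinant is \<open>det Z\<close> times that monomial (lemma \<open>det_monomial_weights\<close>). If \<open>det Z\<close> vanishes
  in \<open>K\<close>, no linear form has maximal rank in degree \<open>s\<close>; otherwise \<open>x + y + z\<close> is bijective there.

  In the other degrees nothing further has to be checked. Surjectivity passes upwards because
  \<open>R/I\<close> is standard graded (lemma \<open>surjective_ascends\<close>). Injectivity passes downwards because
  \<open>R/I\<close> has no socle elements of degree below \<open>s\<close> (lemmas \<open>injective_descends\<close> and
  \<open>low_degree_not_socle\<close>).
\<close>

section \<open>Monomials and polynomials in three variables\<close>

abbreviation unit_exp :: "3 \<Rightarrow> (3 \<Rightarrow>\<^sub>0 nat)" where
  "unit_exp i \<equiv> Poly_Mapping.single i 1"

lemma UNIV_three: "(UNIV :: 3 set) = {0, 1, 2}"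
proof -
  have "card {0, 1, 2 :: 3} = 3" by simp
  then have "{0, 1, 2 :: 3} = UNIV"
    by (intro card_subset_eq) simp_all
  then show ?thesis ..
qed

lemma all_three: "(\<forall>i::3. P i) \<longleftrightarrow> P 0 \<and> P 1 \<and> P 2"
proof -
  have "(\<forall>i\<in>{0, 1, 2}. P i) \<longleftrightarrow> P 0 \<and> P 1 \<and> P 2" by blast
  then show ?thesis unfolding UNIV_three[symmetric] by (simp only: ball_UNIV)
qed

lemma mon_degree_alt:
  "mon_degree m = Poly_Mapping.lookup m 0 + Poly_Mapping.lookup m 1 + Poly_Mapping.lookup m 2"
  unfolding mon_degree_def UNIV_three by simp

lemma mon_degree_add [simp]: "mon_degree (m + k) = mon_degree m + mon_degree k"
  by (simp add: mon_degree_def lookup_add sum.distrib)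

lemma mon_degree_single [simp]: "mon_degree (Poly_Mapping.single i k) = k"
  by (simp add: mon_degree_def lookup_single when_def)

lemma monomial_le_iff:
  fixes m n :: "3 \<Rightarrow>\<^sub>0 nat"
  shows "(\<exists>k. n = m + k) \<longleftrightarrow> (\<forall>i. Poly_Mapping.lookup m i \<le> Poly_Mapping.lookup n i)"
proof
  assume "\<exists>k. n = m + k"
  then show "\<forall>i. Poly_Mapping.lookup m i \<le> Poly_Mapping.lookup n i"
    by (auto simp: lookup_add)
next
  assume "\<forall>i. Poly_Mapping.lookup m i \<le> Poly_Mapping.lookup n i"
  then have "n = m + (n - m)"
    by (intro poly_mapping_eqI) (simp add: lookup_add lookup_minus)
  then show "\<exists>k. n = m + k" ..
qed

lemma split_off_var:
  assumes "mon_degree m > 0"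
  obtains i k where "m = unit_exp i + k"
proof -
  have "\<exists>i. Poly_Mapping.lookup m i \<noteq> 0"
  proof (rule ccontr)
    assume "\<nexists>i. Poly_Mapping.lookup m i \<noteq> 0"
    then show False using assms by (simp add: mon_degree_def)
  qed
  then obtain i where "Poly_Mapping.lookup m i \<noteq> 0" ..
  then have "\<exists>k. m = unit_exp i + k"
    unfolding monomial_le_iff by (auto simp: lookup_single when_def)
  then show ?thesis using that by blast
qed

lemma mon_degree_one:
  assumes "mon_degree k = 1"
  obtains i where "k = unit_exp i"
proof -
  obtain i k' where k: "k = unit_exp i + k'"
    using assms split_off_var[of k] by auto
  then have "mon_degree k' = 0" using assms by simp
  then have "k' = 0"
    by (intro poly_mapping_eqI) (simp add: mon_degree_def)
  then show ?thesis using that k by simp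
qed

lemma finite_monomials_of_degree: "finite {m. int (mon_degree m) = d}"
proof (rule finite_subset)
  let ?g = "\<lambda>(i, j, k). Poly_Mapping.single 0 i + Poly_Mapping.single 1 j + Poly_Mapping.single (2::3) k"
  show "{m. int (mon_degree m) = d} \<subseteq> ?g ` ({..nat d} \<times> {..nat d} \<times> {..nat d})"
  proof
    fix m assume "m \<in> {m. int (mon_degree m) = d}"
    then have "mon_degree m = nat d" by auto
    let ?t = "(Poly_Mapping.lookup m 0, Poly_Mapping.lookup m 1, Poly_Mapping.lookup m 2)"
    have "\<forall>i. Poly_Mapping.lookup m i = Poly_Mapping.lookup (?g ?t) i"
      unfolding all_three by (simp add: lookup_add lookup_single when_def)
    then have "m = ?g ?t" by (intro poly_mapping_eqI) blast
    moreover have "?t \<in> {..nat d} \<times> {..nat d} \<times> {..nat d}"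
      using \<open>mon_degree m = nat d\<close> by (simp add: mon_degree_alt)
    ultimately show "m \<in> ?g ` ({..nat d} \<times> {..nat d} \<times> {..nat d})"
      by (rule image_eqI)
  qed
  show "finite (?g ` ({..nat d} \<times> {..nat d} \<times> {..nat d}))"
    by (intro finite_imageI finite_cartesian_product finite_atMost)
qed

lemma sum_of_monomials:
  fixes f :: "'a \<Rightarrow>\<^sub>0 'k::comm_monoid_add"
  assumes "finite S" and "Poly_Mapping.keys f \<subseteq> S"
  shows "f = (\<Sum>m\<in>S. Poly_Mapping.single m (Poly_Mapping.lookup f m))"
proof (rule poly_mapping_eqI)
  fix n
  have "(\<Sum>m\<in>S. Poly_Mapping.lookup (Poly_Mapping.single m (Poly_Mapping.lookup f m)) n)
      = (\<Sum>m\<in>S. if m = n then Poly_Mapping.lookup f n else 0)"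
    by (intro sum.cong) (auto simp: lookup_single when_def)
  also have "\<dots> = Poly_Mapping.lookup f n"
    using assms by (auto simp: in_keys_iff)
  finally show "Poly_Mapping.lookup f n
      = Poly_Mapping.lookup (\<Sum>m\<in>S. Poly_Mapping.single m (Poly_Mapping.lookup f m)) n"
    by (simp add: lookup_sum)
qed

lemma lookup_single_mult:
  fixes f :: "'k::field poly3"
  shows "Poly_Mapping.lookup (Poly_Mapping.single m c * f) (m + k) = c * Poly_Mapping.lookup f k"
proof -
  have "Poly_Mapping.single m c * f
      = Poly_Mapping.single m c * (\<Sum>n\<in>Poly_Mapping.keys f. Poly_Mapping.single n (Poly_Mapping.lookup f n))"
    by (rule arg_cong[OF sum_of_monomials]) simp_all
  also have "\<dots> = (\<Sum>n\<in>Poly_Mapping.keys f. Poly_Mapping.single (m + n) (c * Poly_Mapping.lookup f n))"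
    by (simp add: sum_distrib_left mult_single)
  finally have "Poly_Mapping.lookup (Poly_Mapping.single m c * f) (m + k)
      = (\<Sum>n\<in>Poly_Mapping.keys f.
          Poly_Mapping.lookup (Poly_Mapping.single (m + n) (c * Poly_Mapping.lookup f n)) (m + k))"
    by (simp only: lookup_sum)
  also have "\<dots> = (\<Sum>n\<in>Poly_Mapping.keys f. if n = k then c * Poly_Mapping.lookup f k else 0)"
    by (intro sum.cong) (auto simp: lookup_single when_def)
  also have "\<dots> = c * Poly_Mapping.lookup f k"
    by (auto simp: in_keys_iff)
  finally show ?thesis .
qed

lemma keys_single_mult: 
  fixes f :: "'k::field poly3"
  assumes "n \<in> Poly_Mapping.keys (Poly_Mapping.single m c * f)"
  obtains k where "k \<in> Poly_Mapping.keys f" "n = m + k"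
  using subsetD[OF keys_mult assms] by (auto split: if_splits)

lemma mon_dvd_iff:
  "(mon m :: 'k::field poly3) dvd mon n \<longleftrightarrow> (\<exists>k. n = m + k)"
proof
  assume "(mon m :: 'k poly3) dvd mon n"
  then obtain q :: "'k poly3" where q: "mon n = mon m * q" by (rule dvdE)
  have "n \<in> Poly_Mapping.keys (mon n :: 'k poly3)" by (simp add: mon_def)
  then have "n \<in> Poly_Mapping.keys (Poly_Mapping.single m 1 * q)"
    by (simp add: q[unfolded mon_def, symmetric])
  then show "\<exists>k. n = m + k"
    by (blast elim: keys_single_mult)
next
  assume "\<exists>k. n = m + k"
  then show "(mon m :: 'k poly3) dvd mon n"
    by (metis dvdI mon_def mult_1_right mult_single)
qed

lemma homogeneous_iff:
  "f \<in> homogeneous d \<longleftrightarrow> Poly_Mapping.keys f \<subseteq> {m. int (mon_degree m) = d}"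
  by (auto simp: homogeneous_def)

lemma zero_homogeneous [simp]: "0 \<in> homogeneous d"
  by (simp add: homogeneous_def)

lemma single_homogeneous: "c = 0 \<or> int (mon_degree m) = d \<Longrightarrow> Poly_Mapping.single m c \<in> homogeneous d"
  by (auto simp: homogeneous_def)

lemma add_homogeneous: "f \<in> homogeneous d \<Longrightarrow> g \<in> homogeneous d \<Longrightarrow> f + g \<in> homogeneous d"
  using Poly_Mapping.keys_add[of f g] by (auto simp: homogeneous_iff)

lemma diff_homogeneous:
  assumes "f \<in> homogeneous d" and "g \<in> homogeneous d"
  shows "f - g \<in> homogeneous d"
proof -
  have "Poly_Mapping.lookup (f - g) m = 0" if "int (mon_degree m) \<noteq> d" for m
    using assms that by (simp add: homogeneous_def lookup_minus) (metis in_keys_iff)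
  then show ?thesis by (auto simp: homogeneous_def in_keys_iff)
qed

lemma sum_homogeneous: "(\<And>x. x \<in> S \<Longrightarrow> f x \<in> homogeneous d) \<Longrightarrow> sum f S \<in> homogeneous d"
  by (induction S rule: infinite_finite_induct) (simp_all add: add_homogeneous)

lemma mult_homogeneous:
  assumes "f \<in> homogeneous d" and "g \<in> homogeneous e"
  shows "f * g \<in> homogeneous (d + e)"
  unfolding homogeneous_def
proof (clarify)
  fix m assume "m \<in> Poly_Mapping.keys (f * g)"
  then obtain k n where "m = k + n" "k \<in> Poly_Mapping.keys f" "n \<in> Poly_Mapping.keys g"
    using keys_mult[of f g] by blast
  then show "int (mon_degree m) = d + e"
    using assms by (auto simp: homogeneous_def)
qed

lemma indet_homogeneous: "indet i \<in> homogeneous 1"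
  by (simp add: indet_def single_homogeneous)

lemma poly3_ring_simps [simp]:
  "carrier poly3_ring = UNIV"
  "f \<otimes>\<^bsub>poly3_ring\<^esub> g = f * g"
  "f \<oplus>\<^bsub>poly3_ring\<^esub> g = f + g"
  "\<zero>\<^bsub>poly3_ring\<^esub> = 0"
  "\<one>\<^bsub>poly3_ring\<^esub> = 1"
  by (simp_all add: ring_of_type_algebra_def)

interpretation poly3: cring "poly3_ring :: 'k::field poly3 ring"
  by (rule cring_from_type_algebra)

lemma poly3_uminus [simp]: "\<ominus>\<^bsub>poly3_ring\<^esub> (f :: 'k::field poly3) = - f"
  using poly3.minus_equality[of "- f" f] by simp

lemma poly3_minus [simp]: "(f :: 'k::field poly3) \<ominus>\<^bsub>poly3_ring\<^esub> g = f - g"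
  by (simp add: a_minus_def)


section \<open>Quotients by monomial ideals\<close>

lemma monomial_ideal_ideal:
  fixes B :: "(3 \<Rightarrow>\<^sub>0 nat) set"
  assumes up: "\<And>m k. m \<in> B \<Longrightarrow> m + k \<in> B"
  shows "ideal {f :: 'k::field poly3. Poly_Mapping.keys f \<subseteq> B} poly3_ring"
proof (rule idealI)
  show "ring (poly3_ring :: 'k poly3 ring)" by (rule poly3.ring_axioms)
  show "subgroup {f. Poly_Mapping.keys f \<subseteq> B} (add_monoid (poly3_ring :: 'k poly3 ring))"
  proof (rule poly3.add.subgroupI)
    show "{f :: 'k poly3. Poly_Mapping.keys f \<subseteq> B} \<noteq> {}"
      by (auto intro: exI[of _ 0])
    fix f g :: "'k poly3"
    assume f: "f \<in> {f. Poly_Mapping.keys f \<subseteq> B}"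
    then show "\<ominus>\<^bsub>poly3_ring\<^esub> f \<in> {f. Poly_Mapping.keys f \<subseteq> B}"
      by (auto simp: in_keys_iff)
    assume "g \<in> {f. Poly_Mapping.keys f \<subseteq> B}"
    with f show "f \<oplus>\<^bsub>poly3_ring\<^esub> g \<in> {f. Poly_Mapping.keys f \<subseteq> B}"
      using Poly_Mapping.keys_add[of f g] by auto
  qed simp
  fix f g :: "'k poly3"
  assume f: "f \<in> {f. Poly_Mapping.keys f \<subseteq> B}"
  have "Poly_Mapping.keys (f * g) \<subseteq> B"
  proof
    fix m assume "m \<in> Poly_Mapping.keys (f * g)"
    then show "m \<in> B" using keys_mult[of f g] f up by blast
  qed
  then show "g \<otimes>\<^bsub>poly3_ring\<^esub> f \<in> {f. Poly_Mapping.keys f \<subseteq> B}"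
    and "f \<otimes>\<^bsub>poly3_ring\<^esub> g \<in> {f. Poly_Mapping.keys f \<subseteq> B}"
    by (simp_all add: mult.commute)
qed

text \<open>
  The ideal generated by monomials is the monomial ideal of their multiples: one inclusion holds
  because the right-hand side is an ideal, the other because every polynomial is the sum of its
  terms.
\<close>

lemma genideal_monomials:
  "Idl\<^bsub>poly3_ring\<^esub> (mon ` G :: 'k::field poly3 set)
    = {f. Poly_Mapping.keys f \<subseteq> {m. \<exists>g\<in>G. \<exists>k. m = g + k}}"
    (is "_ = {f. _ \<subseteq> ?B}")
proof
  have up: "m + k \<in> ?B" if "m \<in> ?B" for m k
  proof -
    from that obtain g k' where "g \<in> G" "m = g + k'" by blast
    then have "m + k = g + (k' + k)" by (simp add: add.assoc)
    with \<open>g \<in> G\<close> show ?thesis by blast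
  qed
  show "Idl\<^bsub>poly3_ring\<^esub> (mon ` G :: 'k poly3 set) \<subseteq> {f. Poly_Mapping.keys f \<subseteq> ?B}"
  proof (rule poly3.genideal_minimal)
    show "ideal {f :: 'k poly3. Poly_Mapping.keys f \<subseteq> ?B} poly3_ring"
      using up by (rule monomial_ideal_ideal)
    show "mon ` G \<subseteq> {f :: 'k poly3. Poly_Mapping.keys f \<subseteq> ?B}"
    proof clarify
      fix g m assume "g \<in> G" and "m \<in> Poly_Mapping.keys (mon g :: 'k poly3)"
      then have "m = g + 0" by (simp add: mon_def)
      with \<open>g \<in> G\<close> show "\<exists>g\<in>G. \<exists>k. m = g + k" by blast
    qed
  qed
  interpret J: ideal "Idl\<^bsub>poly3_ring\<^esub> (mon ` G :: 'k poly3 set)" poly3_ring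
    by (rule poly3.genideal_ideal) simp
  have J_sum: "sum t S \<in> Idl\<^bsub>poly3_ring\<^esub> (mon ` G :: 'k poly3 set)"
    if "\<And>x. x \<in> S \<Longrightarrow> t x \<in> Idl\<^bsub>poly3_ring\<^esub> (mon ` G :: 'k poly3 set)" for S :: "(3 \<Rightarrow>\<^sub>0 nat) set" and t
    using that J.zero_closed J.a_closed
    by (induction S rule: infinite_finite_induct) simp_all
  show "{f. Poly_Mapping.keys f \<subseteq> ?B} \<subseteq> Idl\<^bsub>poly3_ring\<^esub> (mon ` G :: 'k poly3 set)"
  proof clarify
    fix f :: "'k poly3" assume f: "Poly_Mapping.keys f \<subseteq> ?B"
    have "Poly_Mapping.single m (Poly_Mapping.lookup f m) \<in> Idl\<^bsub>poly3_ring\<^esub> (mon ` G)"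
      if "m \<in> Poly_Mapping.keys f" for m
    proof -
      from that f obtain g k where g: "g \<in> G" and m: "m = g + k" by blast
      have "mon g \<in> Idl\<^bsub>poly3_ring\<^esub> (mon ` G :: 'k poly3 set)"
        using g poly3.genideal_self[of "mon ` G"] by auto
      then have "Poly_Mapping.single k (Poly_Mapping.lookup f m) * mon g \<in> Idl\<^bsub>poly3_ring\<^esub> (mon ` G)"
        using J.I_l_closed by simp
      then show ?thesis by (simp add: mon_def mult_single m add.commute)
    qed
    then have "(\<Sum>m\<in>Poly_Mapping.keys f. Poly_Mapping.single m (Poly_Mapping.lookup f m))
        \<in> Idl\<^bsub>poly3_ring\<^esub> (mon ` G)"
      by (rule J_sum)
    then show "f \<in> Idl\<^bsub>poly3_ring\<^esub> (mon ` G)"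
      by (subst sum_of_monomials[of "Poly_Mapping.keys f" f]) simp_all
  qed
qed

text \<open>
  A monomial ideal is determined by the set \<open>B\<close> of monomials that it contains: it consists of the
  polynomials all of whose monomials lie in \<open>B\<close>. Hence a polynomial is determined modulo the ideal
  by its coefficients at the monomials outside \<open>B\<close>, so equality of cosets can be
  tested without reference to generators.
\<close>

locale monomial_ideal =
  fixes B :: "(3 \<Rightarrow>\<^sub>0 nat) set"
    and I :: "'k::field poly3 set"
  assumes B_up: "m \<in> B \<Longrightarrow> m + k \<in> B"
    and I_eq: "I = {f. Poly_Mapping.keys f \<subseteq> B}"
begin

lemma in_I_iff: "f \<in> I \<longleftrightarrow> (\<forall>m. m \<notin> B \<longrightarrow> Poly_Mapping.lookup f m = 0)"
  by (auto simp: I_eq in_keys_iff)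

lemma mon_in_I_iff: "mon m \<in> I \<longleftrightarrow> m \<in> B"
  by (simp add: I_eq mon_def)

lemma ideal_I: "ideal I poly3_ring"
  unfolding I_eq by (rule monomial_ideal_ideal) (rule B_up)

lemma ring_quot: "ring (quot_ring I)"
  unfolding quot_ring_def by (rule ideal.quotient_is_ring[OF ideal_I])

lemma I_add: "f \<in> I \<Longrightarrow> g \<in> I \<Longrightarrow> f + g \<in> I"
  by (simp add: in_I_iff lookup_add)

lemma I_mult: "f \<in> I \<Longrightarrow> g * f \<in> I"
  using ideal.I_l_closed[OF ideal_I, of f g] by simp

abbreviation cls :: "'k poly3 \<Rightarrow> 'k poly3 set" where
  "cls f \<equiv> I +>\<^bsub>poly3_ring\<^esub> f"

lemma cls_eq_iff: "cls f = cls g \<longleftrightarrow> f - g \<in> I"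
  using poly3.quotient_eq_iff_same_a_r_cos[OF ideal_I, of f g] by simp

lemma cls_hom: "ring_hom_ring poly3_ring (quot_ring I) cls"
  unfolding quot_ring_def by (rule ideal.rcos_ring_hom_ring[OF ideal_I])

lemma cls_mult: "cls f \<otimes>\<^bsub>quot_ring I\<^esub> cls g = cls (f * g)"
  using ring_hom_mult[OF ring_hom_ring.homh[OF cls_hom], of f g] by simp

lemma cls_add: "cls f \<oplus>\<^bsub>quot_ring I\<^esub> cls g = cls (f + g)"
  using ring_hom_add[OF ring_hom_ring.homh[OF cls_hom], of f g] by simp

lemma inj_on_quot_part:
  "inj_on (\<lambda>q. cls l \<otimes>\<^bsub>quot_ring I\<^esub> q) (quot_part I d)
    \<longleftrightarrow> (\<forall>f\<in>homogeneous d. l * f \<in> I \<longrightarrow> f \<in> I)" (is "?inj \<longleftrightarrow> ?ker")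
proof
  assume inj: ?inj
  show ?ker
  proof (intro ballI impI)
    fix f assume f: "f \<in> homogeneous d" and "l * f \<in> I"
    then have "cls l \<otimes>\<^bsub>quot_ring I\<^esub> cls f = cls l \<otimes>\<^bsub>quot_ring I\<^esub> cls 0"
      unfolding cls_mult by (simp add: cls_eq_iff)
    with inj f have "cls f = cls 0"
      by (auto simp: inj_on_def quot_part_def)
    then show "f \<in> I" by (simp add: cls_eq_iff)
  qed
next
  assume ker: ?ker
  show ?inj
  proof (rule inj_onI)
    fix p q assume "p \<in> quot_part I d" "q \<in> quot_part I d"
    then obtain f g where f: "f \<in> homogeneous d" "p = cls f" and g: "g \<in> homogeneous d" "q = cls g"
      by (auto simp: quot_part_def)
    assume "cls l \<otimes>\<^bsub>quot_ring I\<^esub> p = cls l \<otimes>\<^bsub>quot_ring I\<^esub> q"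
    then have "l * (f - g) \<in> I"
      by (simp add: f g cls_mult cls_eq_iff right_diff_distrib)
    with ker have "f - g \<in> I" using f g diff_homogeneous by blast
    then show "p = q" by (simp add: f g cls_eq_iff)
  qed
qed

lemma image_quot_part:
  assumes "l \<in> homogeneous 1"
  shows "(\<lambda>q. cls l \<otimes>\<^bsub>quot_ring I\<^esub> q) ` quot_part I d = quot_part I (d + 1)
    \<longleftrightarrow> (\<forall>g\<in>homogeneous (d + 1). \<exists>f\<in>homogeneous d. g - l * f \<in> I)"
proof -
  have "cls l \<otimes>\<^bsub>quot_ring I\<^esub> p \<in> quot_part I (d + 1)" if p: "p \<in> quot_part I d" for p
  proof -
    obtain f where "f \<in> homogeneous d" "p = cls f" using p by (auto simp: quot_part_def)
    then show ?thesis
      using mult_homogeneous[OF assms, of f d] by (simp add: cls_mult quot_part_def add.commute)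
  qed
  then have "(\<lambda>q. cls l \<otimes>\<^bsub>quot_ring I\<^esub> q) ` quot_part I d = quot_part I (d + 1)
    \<longleftrightarrow> quot_part I (d + 1) \<subseteq> (\<lambda>q. cls l \<otimes>\<^bsub>quot_ring I\<^esub> q) ` quot_part I d"
    by blast
  also have "\<dots> \<longleftrightarrow> (\<forall>g\<in>homogeneous (d + 1). \<exists>f\<in>homogeneous d. cls g = cls (l * f))"
    unfolding quot_part_def image_image cls_mult by (auto simp: subset_iff image_iff)
  also have "\<dots> \<longleftrightarrow> (\<forall>g\<in>homogeneous (d + 1). \<exists>f\<in>homogeneous d. g - l * f \<in> I)"
    by (simp add: cls_eq_iff)
  finally show ?thesis .
qed

definition standard :: "int \<Rightarrow> (3 \<Rightarrow>\<^sub>0 nat) set" where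
  "standard d = {m. int (mon_degree m) = d \<and> m \<notin> B}"

lemma finite_standard [simp]: "finite (standard d)"
  unfolding standard_def by (rule finite_subset[OF _ finite_monomials_of_degree[of d]]) auto

text \<open>Discarding the monomials in \<open>B\<close> chooses a representative of each coset.\<close>

lemma restrict_to_standard:
  assumes "f \<in> homogeneous d"
  defines "f' \<equiv> \<Sum>m\<in>standard d. Poly_Mapping.single m (Poly_Mapping.lookup f m)"
  shows "Poly_Mapping.keys f' \<subseteq> standard d" and "f - f' \<in> I"
proof -
  have f': "Poly_Mapping.lookup f' n = (if n \<in> standard d then Poly_Mapping.lookup f n else 0)" for n
  proof -
    have "Poly_Mapping.lookup f' n = (\<Sum>m\<in>standard d. if m = n then Poly_Mapping.lookup f n else 0)"
      unfolding f'_def lookup_sum by (intro sum.cong) (auto simp: lookup_single when_def)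
    then show ?thesis by simp
  qed
  then show "Poly_Mapping.keys f' \<subseteq> standard d"
    by (auto simp: in_keys_iff split: if_splits)
  have "Poly_Mapping.lookup f n = 0" if "n \<notin> B" "n \<notin> standard d" for n
    using that assms(1) by (auto simp: homogeneous_def standard_def in_keys_iff)
  then show "f - f' \<in> I"
    by (simp add: in_I_iff lookup_minus f')
qed

lemma quot_part_eq: "quot_part I d = cls ` {f. Poly_Mapping.keys f \<subseteq> standard d}"
proof
  show "cls ` {f. Poly_Mapping.keys f \<subseteq> standard d} \<subseteq> quot_part I d"
    unfolding quot_part_def by (intro image_mono) (auto simp: homogeneous_iff standard_def)
  show "quot_part I d \<subseteq> cls ` {f. Poly_Mapping.keys f \<subseteq> standard d}"
  proof
    fix p assume "p \<in> quot_part I d"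
    then obtain f where f: "f \<in> homogeneous d" "p = cls f" by (auto simp: quot_part_def)
    from restrict_to_standard[OF f(1)] show "p \<in> cls ` {f. Poly_Mapping.keys f \<subseteq> standard d}"
      unfolding f(2) by (intro image_eqI) (simp_all add: cls_eq_iff)
  qed
qed

text \<open>
  The scalars form a subfield as the image of the field \<open>K\<close> under the ring homomorphism
  sending \<open>c\<close> to the class of the constant \<open>c\<close>; the quotient is not the zero ring because
  \<open>1\<close> is standard.
\<close>

lemma subfield_quot_scalars:
  assumes "0 \<notin> B"
  shows "subfield (quot_scalars I) (quot_ring I)"
proof -
  have "const_poly \<in> Ring.ring_hom (ring_of_type_algebra :: 'k ring) poly3_ring"
    by (rule ring_hom_memI)
      (simp_all add: ring_of_type_algebra_def const_poly_def single_add mult_single)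
  then have hom: "cls \<circ> const_poly \<in> Ring.ring_hom (ring_of_type_algebra :: 'k ring) (quot_ring I)"
    using ring_hom_ring.homh[OF cls_hom] by (rule ring_hom_trans)
  have K: "field (ring_of_type_algebra :: 'k ring)" by (rule field_from_type_algebra)
  have "ring_hom_ring (ring_of_type_algebra :: 'k ring) (quot_ring I) (cls \<circ> const_poly)"
    by (rule ring_hom_ringI2[OF ring_from_type_algebra ring_quot hom])
  then have "subfield ((cls \<circ> const_poly) ` carrier ring_of_type_algebra) (quot_ring I)"
  proof (rule ring_hom_ring.img_is_subfield(2))
    show "subfield (carrier (ring_of_type_algebra :: 'k ring)) ring_of_type_algebra"
      by (rule field.carrier_is_subfield[OF K])
    have "cls 1 \<noteq> cls 0"
      using assms by (auto simp: cls_eq_iff in_I_iff lookup_one)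
    moreover have "cls 1 = \<one>\<^bsub>quot_ring I\<^esub>"
      using ring_hom_one[OF ring_hom_ring.homh[OF cls_hom]] by simp
    moreover have "cls 0 = \<zero>\<^bsub>quot_ring I\<^esub>"
      using ring_hom_zero[OF ring_hom_ring.homh[OF cls_hom] poly3.ring_axioms ring_quot] by simp
    ultimately show "\<one>\<^bsub>quot_ring I\<^esub> \<noteq> \<zero>\<^bsub>quot_ring I\<^esub>" by simp
  qed
  moreover have "carrier (ring_of_type_algebra :: 'k ring) = UNIV"
    by (simp add: ring_of_type_algebra_def)
  ultimately show ?thesis
    by (simp add: quot_scalars_def o_def)
qed

text \<open>
  Adjoining a standard monomial \<open>m\<close> to \<open>S\<close> extends the span by a line: polynomials supported in \<open>S\<close>
  have coefficient \<open>0\<close> at \<open>m\<close>, and this coefficient depends only on the coset.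
\<close>

lemma dimension_standard_span:
  assumes "finite S" and "S \<inter> B = {}"
  shows "ring.dimension (quot_ring I) (card S) (quot_scalars I) (cls ` {f. Poly_Mapping.keys f \<subseteq> S})"
  using assms
proof (induction S rule: finite_induct)
  case empty
  have "cls 0 = \<zero>\<^bsub>quot_ring I\<^esub>"
    using ring_hom_zero[OF ring_hom_ring.homh[OF cls_hom] poly3.ring_axioms ring_quot] by simp
  then show ?case
    using ring.dimension.zero_dim[OF ring_quot] by simp
next
  case (insert m S)
  let ?E = "cls ` {f. Poly_Mapping.keys f \<subseteq> S}"
  have "cls (mon m) \<notin> ?E"
  proof
    assume "cls (mon m) \<in> ?E"
    then obtain f where f: "Poly_Mapping.keys f \<subseteq> S" "mon m - f \<in> I"
      by (auto simp: cls_eq_iff)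
    have "Poly_Mapping.lookup f m = 0"
      using f(1) insert.hyps by (auto simp: in_keys_iff)
    moreover have "Poly_Mapping.lookup (mon m - f) m = 0"
      using f(2) insert.prems by (auto simp: in_I_iff)
    ultimately show False by (simp add: lookup_minus mon_def)
  qed
  moreover have "cls (mon m) \<in> carrier (quot_ring I)"
    using ring_hom_closed[OF ring_hom_ring.homh[OF cls_hom]] by simp
  moreover have "ring.dimension (quot_ring I) (card S) (quot_scalars I) ?E"
    using insert by auto
  ultimately have "ring.dimension (quot_ring I) (Suc (card S)) (quot_scalars I)
      (ring.line_extension (quot_ring I) (quot_scalars I) (cls (mon m)) ?E)"
    using ring.Suc_dim[OF ring_quot] by blast
  moreover have "ring.line_extension (quot_ring I) (quot_scalars I) (cls (mon m)) ?E
      = cls ` {f. Poly_Mapping.keys f \<subseteq> insert m S}"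
  proof -
    have "ring.line_extension (quot_ring I) (quot_scalars I) (cls (mon m)) ?E
        = {cls (const_poly c * mon m + f) | c f. Poly_Mapping.keys f \<subseteq> S}"
      unfolding ring.line_extension_def[OF ring_quot] set_add_def' r_coset_def quot_scalars_def
      by (auto simp: cls_mult cls_add)
    also have "\<dots> = cls ` {f. Poly_Mapping.keys f \<subseteq> insert m S}" (is "?L = ?R")
    proof
      show "?L \<subseteq> ?R"
      proof clarify
        fix c and f :: "'k poly3" assume f: "Poly_Mapping.keys f \<subseteq> S"
        have "Poly_Mapping.keys (const_poly c * mon m + f) \<subseteq> insert m S"
          using f keys_add[of "const_poly c * mon m" f]
          by (auto simp: const_poly_def mon_def mult_single split: if_splits)
        then show "cls (const_poly c * mon m + f) \<in> ?R" by blast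
      qed
      show "?R \<subseteq> ?L"
      proof clarify
        fix f :: "'k poly3" assume f: "Poly_Mapping.keys f \<subseteq> insert m S"
        let ?g = "f - Poly_Mapping.single m (Poly_Mapping.lookup f m)"
        have "Poly_Mapping.lookup ?g n = 0" if "n \<notin> S" for n
          using f that by (cases "n = m") (auto simp: lookup_minus lookup_single in_keys_iff)
        then have "Poly_Mapping.keys ?g \<subseteq> S" by (auto simp: in_keys_iff)
        moreover have "f = const_poly (Poly_Mapping.lookup f m) * mon m + ?g"
          by (simp add: const_poly_def mon_def mult_single)
        ultimately show "\<exists>c g. cls f = cls (const_poly c * mon m + g) \<and> Poly_Mapping.keys g \<subseteq> S"
          by metis
      qed
    qed
    finally show ?thesis .
  qed
  ultimately show ?case using insert.hyps by simp
qed

lemma hilbert_function_eq: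
  assumes "0 \<notin> B"
  shows "hilbert_function I d = card (standard d)"
proof -
  have "ring.dimension (quot_ring I) (card (standard d)) (quot_scalars I) (quot_part I d)"
    unfolding quot_part_eq by (rule dimension_standard_span) (simp, auto simp: standard_def)
  then show ?thesis
    using ring.dimI[OF ring_quot subfield_quot_scalars[OF assms]]
    by (simp add: hilbert_function_def over_def)
qed


section \<open>Passing injectivity and surjectivity between degrees\<close>

text \<open>
  If \<open>f\<close> is killed by \<open>l\<close> then so is each \<open>x\<^sub>i f\<close>, one degree higher. Without socle elements
  in low degrees some \<open>x\<^sub>i f\<close> is nonzero, so injectivity passes to lower degrees.
\<close>

lemma injective_descends:
  assumes no_socle: "\<And>m. m \<notin> B \<Longrightarrow> int (mon_degree m) < s \<Longrightarrow> \<exists>i. unit_exp i + m \<notin> B"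
    and inj: "\<forall>f\<in>homogeneous s. l * f \<in> I \<longrightarrow> f \<in> I"
    and "d \<le> s"
  shows "\<forall>f\<in>homogeneous d. l * f \<in> I \<longrightarrow> f \<in> I"
  using \<open>d \<le> s\<close>
proof (induction d rule: int_le_induct)
  case base
  show ?case by (rule inj)
next
  case (step d)
  show ?case
  proof (intro ballI impI)
    fix f assume f: "f \<in> homogeneous (d - 1)" and "l * f \<in> I"
    have var_f: "indet i * f \<in> I" for i
    proof -
      have "indet i * f \<in> homogeneous d"
        using mult_homogeneous[OF indet_homogeneous f, of i] by simp
      moreover have "l * (indet i * f) \<in> I"
        using I_mult[OF \<open>l * f \<in> I\<close>, of "indet i"] by (simp add: mult.left_commute)
      ultimately show ?thesis using step.IH by blast
    qed
    show "f \<in> I"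
      unfolding in_I_iff
    proof (intro allI impI, rule ccontr)
      fix m assume "m \<notin> B" and m: "Poly_Mapping.lookup f m \<noteq> 0"
      then have "int (mon_degree m) = d - 1"
        using f by (simp add: homogeneous_def in_keys_iff)
      then obtain i where "unit_exp i + m \<notin> B"
        using no_socle[OF \<open>m \<notin> B\<close>] step.hyps by auto
      then have "Poly_Mapping.lookup (indet i * f) (unit_exp i + m) = 0"
        using var_f[of i] unfolding in_I_iff by blast
      then show False
        using m lookup_single_mult[of "unit_exp i" 1 f m] by (simp add: indet_def)
    qed
  qed
qed

text \<open>
  The quotient is generated in degree \<open>1\<close>, so surjectivity passes to higher degrees: a
  monomial of degree \<open>d + 2\<close> is \<open>x\<^sub>i\<close> times one of degree \<open>d + 1\<close>.
\<close>

lemma surjective_ascends: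
  assumes surj: "\<forall>g\<in>homogeneous (s + 1). \<exists>f\<in>homogeneous s. g - l * f \<in> I"
    and "0 \<le> s" and "s \<le> d"
  shows "\<forall>g\<in>homogeneous (d + 1). \<exists>f\<in>homogeneous d. g - l * f \<in> I"
  using \<open>s \<le> d\<close>
proof (induction d rule: int_ge_induct)
  case base
  show ?case by (rule surj)
next
  case (step d)
  let ?P = "\<lambda>g. \<exists>f\<in>homogeneous (d + 1). g - l * f \<in> I"
  have P_single: "?P (Poly_Mapping.single m c)" if m: "int (mon_degree m) = d + 2" for m c
  proof -
    obtain i k where k: "m = unit_exp i + k"
      using m step.hyps \<open>0 \<le> s\<close> split_off_var[of m] by auto
    then have "Poly_Mapping.single k c \<in> homogeneous (d + 1)"
      using m by (intro single_homogeneous) simp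
    then obtain f where f: "f \<in> homogeneous d" "Poly_Mapping.single k c - l * f \<in> I"
      using step.IH by blast
    have "indet i * (Poly_Mapping.single k c - l * f) = Poly_Mapping.single m c - l * (indet i * f)"
      by (simp add: k indet_def right_diff_distrib mult_single mult.left_commute)
    then have "Poly_Mapping.single m c - l * (indet i * f) \<in> I"
      using I_mult[OF f(2), of "indet i"] by simp
    moreover have "indet i * f \<in> homogeneous (d + 1)"
      using mult_homogeneous[OF indet_homogeneous f(1), of i] by (simp add: add.commute)
    ultimately show ?thesis by blast
  qed
  have P_sum: "?P (sum g S)" if "\<And>m. m \<in> S \<Longrightarrow> ?P (g m)" for g :: "_ \<Rightarrow> 'k poly3" and S :: "(3 \<Rightarrow>\<^sub>0 nat) set"
    using that
  proof (induction S rule: infinite_finite_induct)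
    case (insert m S)
    then obtain f f' where "f \<in> homogeneous (d + 1)" "g m - l * f \<in> I"
        and "f' \<in> homogeneous (d + 1)" "sum g S - l * f' \<in> I"
      by blast
    then have "f + f' \<in> homogeneous (d + 1)" "sum g (insert m S) - l * (f + f') \<in> I"
      using I_add[of "g m - l * f" "sum g S - l * f'"] insert.hyps
      by (simp_all add: add_homogeneous algebra_simps)
    then show ?case by blast
  qed (auto intro!: bexI[of _ 0] simp: in_I_iff)
  show ?case
  proof
    fix g :: "'k poly3" assume g: "g \<in> homogeneous (d + 1 + 1)"
    have "?P (\<Sum>m\<in>Poly_Mapping.keys g. Poly_Mapping.single m (Poly_Mapping.lookup g m))"
      using g by (intro P_sum P_single) (simp add: homogeneous_def)
    then show "?P g"
      by (subst sum_of_monomials[of "Poly_Mapping.keys g" g]) simp_all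
  qed
qed

end

section \<open>The determinant of multiplication by a linear form\<close>

definition monomial_value :: "(3 \<Rightarrow> 'k::comm_ring_1) \<Rightarrow> (3 \<Rightarrow>\<^sub>0 nat) \<Rightarrow> 'k" where
  "monomial_value w k = (\<Prod>i\<in>UNIV. w i ^ Poly_Mapping.lookup k i)"

lemma monomial_value_add: "monomial_value w (k + k') = monomial_value w k * monomial_value w k'"
  by (simp add: monomial_value_def lookup_add power_add prod.distrib)

lemma monomial_value_sum: "monomial_value w (sum k S) = (\<Prod>x\<in>S. monomial_value w (k x))"
  by (induction S rule: infinite_finite_induct)
    (simp_all add: monomial_value_add, simp_all add: monomial_value_def)

lemma monomial_value_one [simp]: "monomial_value (\<lambda>i. 1) k = 1"
  by (simp add: monomial_value_def)

lemma single_left_inj: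
  fixes k :: "'k::zero"
  assumes "k \<noteq> 0"
  shows "Poly_Mapping.single i k = Poly_Mapping.single j k \<longleftrightarrow> i = j"
  using assms by (metis lookup_single_eq lookup_single_not_eq)

lemma monomial_value_unit_exp: "monomial_value w (unit_exp i) = w i"
proof -
  have "monomial_value w (unit_exp i) = (\<Prod>j\<in>UNIV. if j = i then w i else 1)"
    unfolding monomial_value_def by (intro prod.cong) (auto simp: lookup_single when_def)
  then show ?thesis by simp
qed

text \<open>
  In the Leibniz expansion, every nonzero term carries the same factor: the quotient of the product
  of all column monomials by the product of all row monomials, whichever permutation matches them.
\<close>

lemma det_monomial_weights:
  fixes Z :: "'k::comm_ring_1 mat" and m n :: "nat \<Rightarrow> (3 \<Rightarrow>\<^sub>0 nat)"
  assumes Z: "Z \<in> carrier_mat h h"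
    and dvd: "\<And>i j. i < h \<Longrightarrow> j < h \<Longrightarrow> Z $$ (i, j) \<noteq> 0 \<Longrightarrow> \<exists>k. n j = m i + k"
  shows "det (mat h h (\<lambda>(i, j). Z $$ (i, j) * monomial_value w (n j - m i)))
    = det Z * monomial_value w ((\<Sum>j<h. n j) - (\<Sum>i<h. m i))"
proof -
  let ?W = "monomial_value w ((\<Sum>j<h. n j) - (\<Sum>i<h. m i))"
  have product: "(\<Prod>i<h. Z $$ (i, p i) * monomial_value w (n (p i) - m i))
      = (\<Prod>i<h. Z $$ (i, p i)) * ?W" if p: "p permutes {..<h}" for p
  proof (cases "\<forall>i<h. Z $$ (i, p i) \<noteq> 0")
    case True
    have p_less: "p i < h" if "i < h" for i
      using permutes_in_image[OF p, of i] that by simp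
    have "(\<Sum>j<h. n j) = (\<Sum>i<h. n (p i))"
      using sum.permute[OF p, of n] by (simp add: o_def)
    also have "\<dots> = (\<Sum>i<h. m i + (n (p i) - m i))"
    proof (intro sum.cong refl)
      fix i assume "i \<in> {..<h}"
      then obtain k where "n (p i) = m i + k" using dvd[of i "p i"] True p_less by auto
      then show "n (p i) = m i + (n (p i) - m i)" by simp
    qed
    also have "\<dots> = (\<Sum>i<h. m i) + (\<Sum>i<h. n (p i) - m i)"
      by (rule sum.distrib)
    finally have "(\<Sum>j<h. n j) - (\<Sum>i<h. m i) = (\<Sum>i<h. n (p i) - m i)"
      by simp
    then show ?thesis
      by (simp add: prod.distrib monomial_value_sum)
  next
    case False
    then obtain i where i: "i < h" "Z $$ (i, p i) = 0" by blast
    then have "(\<Prod>i<h. Z $$ (i, p i)) = 0"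
      and "(\<Prod>i<h. Z $$ (i, p i) * monomial_value w (n (p i) - m i)) = 0"
      by (auto intro!: prod_zero bexI[of _ i])
    then show ?thesis by simp
  qed
  let ?N = "mat h h (\<lambda>(i, j). Z $$ (i, j) * monomial_value w (n j - m i))"
  have "det ?N = (\<Sum>p\<in>{p. p permutes {..<h}}. signof p * (\<Prod>i<h. ?N $$ (i, p i)))"
    by (subst det_def'[where n = h]) (simp_all add: atLeast0LessThan)
  also have "\<dots> = (\<Sum>p\<in>{p. p permutes {..<h}}. (signof p * (\<Prod>i<h. Z $$ (i, p i))) * ?W)"
  proof (intro sum.cong refl)
    fix p assume "p \<in> {p. p permutes {..<h}}"
    then have p: "p permutes {..<h}" by simp
    have "(\<Prod>i<h. ?N $$ (i, p i)) = (\<Prod>i<h. Z $$ (i, p i) * monomial_value w (n (p i) - m i))"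
      using permutes_in_image[OF p] by (intro prod.cong) simp_all
    then show "signof p * (\<Prod>i<h. ?N $$ (i, p i)) = signof p * (\<Prod>i<h. Z $$ (i, p i)) * ?W"
      unfolding product[OF p] by (simp only: mult.assoc)
  qed
  also have "\<dots> = det Z * ?W"
    by (subst det_def'[OF Z]) (simp add: atLeast0LessThan sum_distrib_right)
  finally show ?thesis .
qed

text \<open>
  A monomial of degree one is a variable, so its coefficient in \<open>l\<close> is its value at the
  coefficients of \<open>l\<close>. Writing it this way makes the matrix of \<open>\<times>l\<close> an instance of the
  previous lemma.
\<close>

lemma lookup_linear_form:
  assumes "mon_degree k = 1"
  shows "Poly_Mapping.lookup l k = monomial_value (\<lambda>i. Poly_Mapping.lookup l (unit_exp i)) k"
proof -
  obtain i where "k = unit_exp i" using assms by (rule mon_degree_one)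
  then show ?thesis by (simp only: monomial_value_unit_exp)
qed

text \<open>
  Lists enumerating the standard monomials of degrees \<open>s\<close> and \<open>s + 1\<close> have the same length \<open>h\<close>, so
  that \<open>\<times>l\<close> has a square matrix between these degrees.
\<close>

locale balanced_degree = monomial_ideal B I
  for B and I :: "'k::field poly3 set" +
  fixes s :: int and h :: nat and ms ns :: "(3 \<Rightarrow>\<^sub>0 nat) list"
  assumes ms: "distinct ms" "set ms = standard s" "length ms = h"
    and ns: "distinct ns" "set ns = standard (s + 1)" "length ns = h"
begin

definition mult_matrix :: "'k poly3 \<Rightarrow> 'k mat" where
  "mult_matrix l = mat h h (\<lambda>(i, j).
     if \<exists>k. ns ! j = ms ! i + k then Poly_Mapping.lookup l (ns ! j - ms ! i) else 0)"

definition incidence_matrix :: "'k mat" where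
  "incidence_matrix = mat h h (\<lambda>(i, j). if \<exists>k. ns ! j = ms ! i + k then 1 else 0)"

lemma mult_matrix_carrier: "mult_matrix l \<in> carrier_mat h h"
  by (simp add: mult_matrix_def)

lemma mult_matrix_eq_weighted:
  "mult_matrix l = mat h h (\<lambda>(i, j). incidence_matrix $$ (i, j)
     * monomial_value (\<lambda>i. Poly_Mapping.lookup l (unit_exp i)) (ns ! j - ms ! i))"
proof (rule eq_matI)
  fix i j assume "i < dim_row (mat h h (\<lambda>(i, j). incidence_matrix $$ (i, j)
     * monomial_value (\<lambda>i. Poly_Mapping.lookup l (unit_exp i)) (ns ! j - ms ! i)))"
    and "j < dim_col (mat h h (\<lambda>(i, j). incidence_matrix $$ (i, j)
     * monomial_value (\<lambda>i. Poly_Mapping.lookup l (unit_exp i)) (ns ! j - ms ! i)))"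
  then have i: "i < h" and j: "j < h" by simp_all
  have "int (mon_degree (ms ! i)) = s" "int (mon_degree (ns ! j)) = s + 1"
    using nth_mem[of i ms] nth_mem[of j ns] i j ms ns by (simp_all add: standard_def)
  then have "mon_degree k = 1" if "ns ! j = ms ! i + k" for k
    using that by simp
  then have "Poly_Mapping.lookup l (ns ! j - ms ! i)
      = monomial_value (\<lambda>i. Poly_Mapping.lookup l (unit_exp i)) (ns ! j - ms ! i)"
    if "\<exists>k. ns ! j = ms ! i + k"
    using that lookup_linear_form by (metis add_diff_cancel_left')
  then show "mult_matrix l $$ (i, j) = mat h h (\<lambda>(i, j). incidence_matrix $$ (i, j)
     * monomial_value (\<lambda>i. Poly_Mapping.lookup l (unit_exp i)) (ns ! j - ms ! i)) $$ (i, j)"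
    using i j by (simp add: mult_matrix_def incidence_matrix_def)
qed (simp_all add: mult_matrix_def)

lemma det_mult_matrix:
  "\<exists>u. det (mult_matrix l) = det incidence_matrix * u"
  unfolding mult_matrix_eq_weighted
  by (intro exI, rule det_monomial_weights) (auto simp: incidence_matrix_def split: if_splits)

lemma mult_matrix_sum_of_variables: "mult_matrix (\<Sum>i\<in>UNIV. indet i) = incidence_matrix"
proof -
  have "Poly_Mapping.lookup (\<Sum>i\<in>UNIV. indet i) (unit_exp j) = (1 :: 'k)" for j
  proof -
    have "Poly_Mapping.lookup (\<Sum>i\<in>UNIV. indet i) (unit_exp j) = (\<Sum>i\<in>UNIV. if i = j then 1 else 0 :: 'k)"
      unfolding lookup_sum indet_def
      by (intro sum.cong) (auto simp: lookup_single when_def single_left_inj)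
    then show ?thesis by simp
  qed
  then show ?thesis
    unfolding mult_matrix_eq_weighted by (intro eq_matI) (simp_all add: incidence_matrix_def)
qed

definition coeffs_s :: "'k poly3 \<Rightarrow> 'k vec" where
  "coeffs_s f = vec h (\<lambda>i. Poly_Mapping.lookup f (ms ! i))"

definition coeffs_Suc :: "'k poly3 \<Rightarrow> 'k vec" where
  "coeffs_Suc g = vec h (\<lambda>j. Poly_Mapping.lookup g (ns ! j))"

definition poly_of_vec :: "'k vec \<Rightarrow> 'k poly3" where
  "poly_of_vec v = (\<Sum>i<h. Poly_Mapping.single (ms ! i) (v $ i))"

lemma coeffs_carrier: "coeffs_s f \<in> carrier_vec h" "coeffs_Suc f \<in> carrier_vec h"
  by (simp_all add: coeffs_s_def coeffs_Suc_def)

lemma poly_of_vec_homogeneous: "poly_of_vec v \<in> homogeneous s"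
proof -
  have "int (mon_degree (ms ! i)) = s" if "i < h" for i
    using nth_mem[of i ms] that ms by (simp add: standard_def)
  then show ?thesis
    unfolding poly_of_vec_def by (intro sum_homogeneous single_homogeneous) simp
qed

lemma coeffs_poly_of_vec:
  assumes "v \<in> carrier_vec h"
  shows "coeffs_s (poly_of_vec v) = v"
proof (rule eq_vecI)
  fix j assume "j < dim_vec v"
  then have j: "j < h" using assms by simp
  have "Poly_Mapping.lookup (poly_of_vec v) (ms ! j) = (\<Sum>i<h. if i = j then v $ i else 0)"
    unfolding poly_of_vec_def lookup_sum using j ms
    by (intro sum.cong) (auto simp: lookup_single when_def nth_eq_iff_index_eq)
  then show "coeffs_s (poly_of_vec v) $ j = v $ j"
    using j by (simp add: coeffs_s_def)
qed (use assms in \<open>simp add: coeffs_s_def\<close>)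

lemma homogeneous_in_I_iff:
  assumes "f \<in> homogeneous d"
  shows "f \<in> I \<longleftrightarrow> (\<forall>m\<in>standard d. Poly_Mapping.lookup f m = 0)"
  using assms unfolding in_I_iff by (auto simp: homogeneous_def standard_def in_keys_iff)

lemma in_I_iff_coeffs_s:
  assumes "f \<in> homogeneous s"
  shows "f \<in> I \<longleftrightarrow> coeffs_s f = 0\<^sub>v h"
  unfolding homogeneous_in_I_iff[OF assms] ms(2)[symmetric] all_set_conv_all_nth coeffs_s_def
  by (auto simp: vec_eq_iff ms(3))

lemma in_I_iff_coeffs_Suc:
  assumes "g \<in> homogeneous (s + 1)"
  shows "g \<in> I \<longleftrightarrow> coeffs_Suc g = 0\<^sub>v h"
  unfolding homogeneous_in_I_iff[OF assms] ns(2)[symmetric] all_set_conv_all_nth coeffs_Suc_def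
  by (auto simp: vec_eq_iff ns(3))

text \<open>
  Rows of the matrix are indexed by the monomials of the source, so its transpose acts on
  coefficient vectors.
\<close>

lemma coeffs_mult:
  assumes f: "f \<in> homogeneous s"
  shows "coeffs_Suc (l * f) = transpose_mat (mult_matrix l) *\<^sub>v coeffs_s f"
proof (rule eq_vecI)
  fix j assume "j < dim_vec (transpose_mat (mult_matrix l) *\<^sub>v coeffs_s f)"
  then have j: "j < h" by (simp add: mult_matrix_def)
  let ?n = "ns ! j"
  let ?t = "\<lambda>m. if \<exists>k. ?n = m + k then Poly_Mapping.lookup l (?n - m) * Poly_Mapping.lookup f m else 0"
  have "?n \<notin> B" using nth_mem[of j ns] j ns by (simp add: standard_def)
  have "l * f = l * (\<Sum>m\<in>Poly_Mapping.keys f. Poly_Mapping.single m (Poly_Mapping.lookup f m))"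
    by (rule arg_cong[OF sum_of_monomials]) simp_all
  also have "\<dots> = (\<Sum>m\<in>Poly_Mapping.keys f. Poly_Mapping.single m (Poly_Mapping.lookup f m) * l)"
    by (simp add: sum_distrib_left mult.commute)
  finally have "Poly_Mapping.lookup (l * f) ?n = (\<Sum>m\<in>Poly_Mapping.keys f.
      Poly_Mapping.lookup (Poly_Mapping.single m (Poly_Mapping.lookup f m) * l) ?n)"
    by (simp only: lookup_sum)
  also have "\<dots> = (\<Sum>m\<in>Poly_Mapping.keys f. ?t m)"
  proof (intro sum.cong refl)
    fix m
    show "Poly_Mapping.lookup (Poly_Mapping.single m (Poly_Mapping.lookup f m) * l) ?n = ?t m"
    proof (cases "\<exists>k. ?n = m + k")
      case True
      then obtain k where "?n = m + k" ..
      then show ?thesis by (simp add: lookup_single_mult)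
    next
      case False
      then have "?n \<notin> Poly_Mapping.keys (Poly_Mapping.single m (Poly_Mapping.lookup f m) * l)"
        by (blast elim: keys_single_mult)
      with False show ?thesis by (simp add: in_keys_iff)
    qed
  qed
  \<comment> \<open>Multiples of monomials in \<open>B\<close> stay in \<open>B\<close>, so only standard monomials of \<open>f\<close> contribute.\<close>
  also have "\<dots> = (\<Sum>m\<in>standard s. ?t m)"
  proof (rule sum.mono_neutral_cong)
    show "?t m = 0" if "m \<in> Poly_Mapping.keys f - standard s" for m
    proof -
      have "m \<in> B" using that f by (auto simp: homogeneous_def standard_def)
      then have "\<nexists>k. ?n = m + k" using B_up \<open>?n \<notin> B\<close> by metis
      then show ?thesis by simp
    qed
  qed (auto simp: in_keys_iff)
  also have "\<dots> = (\<Sum>i<h. ?t (ms ! i))"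
    using bij_betw_nth[OF ms(1), of "{..<h}" "standard s"] ms
    by (intro sum.reindex_bij_betw[symmetric]) simp
  also have "\<dots> = (transpose_mat (mult_matrix l) *\<^sub>v coeffs_s f) $ j"
    using j by (auto simp: mult_matrix_def coeffs_s_def scalar_prod_def atLeast0LessThan intro!: sum.cong)
  finally show "coeffs_Suc (l * f) $ j = (transpose_mat (mult_matrix l) *\<^sub>v coeffs_s f) $ j"
    using j by (simp add: coeffs_Suc_def)
qed (simp add: coeffs_Suc_def mult_matrix_def)

lemma injective_iff_det:
  assumes l: "l \<in> homogeneous 1"
  shows "(\<forall>f\<in>homogeneous s. l * f \<in> I \<longrightarrow> f \<in> I) \<longleftrightarrow> det (mult_matrix l) \<noteq> 0"
proof -
  let ?A = "transpose_mat (mult_matrix l)"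
  have A: "?A \<in> carrier_mat h h" using mult_matrix_carrier by simp
  have ker: "l * f \<in> I \<longleftrightarrow> ?A *\<^sub>v coeffs_s f = 0\<^sub>v h" if "f \<in> homogeneous s" for f
    using mult_homogeneous[OF l that] in_I_iff_coeffs_Suc[of "l * f"] coeffs_mult[OF that]
    by (simp add: add.commute)
  have "(\<forall>f\<in>homogeneous s. l * f \<in> I \<longrightarrow> f \<in> I)
      \<longleftrightarrow> (\<forall>f\<in>homogeneous s. ?A *\<^sub>v coeffs_s f = 0\<^sub>v h \<longrightarrow> coeffs_s f = 0\<^sub>v h)"
    using ker in_I_iff_coeffs_s by simp
  also have "\<dots> \<longleftrightarrow> (\<forall>v\<in>carrier_vec h. ?A *\<^sub>v v = 0\<^sub>v h \<longrightarrow> v = 0\<^sub>v h)"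
    using coeffs_carrier poly_of_vec_homogeneous coeffs_poly_of_vec by metis
  also have "\<dots> \<longleftrightarrow> det ?A \<noteq> 0"
    unfolding det_0_iff_vec_prod_zero[OF A] by blast
  finally show ?thesis
    unfolding det_transpose[OF mult_matrix_carrier] .
qed

text \<open>
  Preimages of the standard monomials of degree \<open>s + 1\<close> form the columns of a right inverse;
  conversely, the adjugate matrix produces preimages.
\<close>

lemma surjective_iff_det:
  assumes l: "l \<in> homogeneous 1"
  shows "(\<forall>g\<in>homogeneous (s + 1). \<exists>f\<in>homogeneous s. g - l * f \<in> I) \<longleftrightarrow> det (mult_matrix l) \<noteq> 0"
    (is "?surj \<longleftrightarrow> _")
proof -
  let ?A = "transpose_mat (mult_matrix l)"
  have A: "?A \<in> carrier_mat h h" using mult_matrix_carrier by simp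
  have cong: "g - l * f \<in> I \<longleftrightarrow> coeffs_Suc g = ?A *\<^sub>v coeffs_s f"
    if "g \<in> homogeneous (s + 1)" "f \<in> homogeneous s" for f g
  proof -
    have "l * f \<in> homogeneous (s + 1)"
      using mult_homogeneous[OF l that(2)] by (simp add: add.commute)
    then have "g - l * f \<in> I \<longleftrightarrow> coeffs_Suc (g - l * f) = 0\<^sub>v h"
      using that(1) by (intro in_I_iff_coeffs_Suc diff_homogeneous)
    also have "\<dots> \<longleftrightarrow> coeffs_Suc g = coeffs_Suc (l * f)"
      by (auto simp: coeffs_Suc_def vec_eq_iff lookup_minus)
    finally show ?thesis unfolding coeffs_mult[OF that(2)] .
  qed
  have "?surj \<longleftrightarrow> det ?A \<noteq> 0"
  proof
    assume surj: ?surj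
    have "\<exists>f\<in>homogeneous s. ?A *\<^sub>v coeffs_s f = unit_vec h j" if j: "j < h" for j
    proof -
      have hom: "mon (ns ! j) \<in> homogeneous (s + 1)"
        using nth_mem[of j ns] j ns by (simp add: mon_def standard_def single_homogeneous)
      moreover have "coeffs_Suc (mon (ns ! j)) = unit_vec h j"
        using j ns
        by (intro eq_vecI) (auto simp: coeffs_Suc_def mon_def lookup_single when_def nth_eq_iff_index_eq)
      ultimately show ?thesis using surj cong by metis
    qed
    then obtain f where f: "\<And>j. j < h \<Longrightarrow> ?A *\<^sub>v coeffs_s (f j) = unit_vec h j" by metis
    define Y where "Y = mat h h (\<lambda>(i, j). coeffs_s (f j) $ i)"
    have Y: "Y \<in> carrier_mat h h" by (simp add: Y_def)
    have "?A * Y = 1\<^sub>m h"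
    proof (rule eq_matI)
      fix i j assume "i < dim_row (1\<^sub>m h :: 'k mat)" "j < dim_col (1\<^sub>m h :: 'k mat)"
      then have ij: "i < h" "j < h" by simp_all
      have "col Y j = coeffs_s (f j)"
        using ij by (intro eq_vecI) (simp_all add: Y_def coeffs_s_def)
      then have "(?A * Y) $$ (i, j) = (?A *\<^sub>v coeffs_s (f j)) $ i"
        using ij A Y by (simp add: mult_matrix_def)
      then show "(?A * Y) $$ (i, j) = 1\<^sub>m h $$ (i, j)"
        using ij f by simp
    qed (use A Y in simp_all)
    then have "det ?A * det Y = 1"
      using det_mult[OF A Y] by simp
    then show "det ?A \<noteq> 0" by auto
  next
    assume det: "det ?A \<noteq> 0"
    show ?surj
    proof
      fix g :: "'k poly3" assume g: "g \<in> homogeneous (s + 1)"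
      define v where "v = inverse (det ?A) \<cdot>\<^sub>v (adj_mat ?A *\<^sub>v coeffs_Suc g)"
      have v: "v \<in> carrier_vec h"
        using adj_mat(1)[OF A] coeffs_carrier(2)[of g] by (auto simp: v_def)
      have "?A *\<^sub>v v = inverse (det ?A) \<cdot>\<^sub>v (?A *\<^sub>v (adj_mat ?A *\<^sub>v coeffs_Suc g))"
        unfolding v_def using adj_mat(1)[OF A] coeffs_carrier(2)[of g]
        by (intro mult_mat_vec[OF A]) auto
      also have "?A *\<^sub>v (adj_mat ?A *\<^sub>v coeffs_Suc g) = (det ?A \<cdot>\<^sub>m 1\<^sub>m h) *\<^sub>v coeffs_Suc g"
        unfolding adj_mat(2)[OF A, symmetric]
        by (rule assoc_mult_mat_vec[OF A adj_mat(1)[OF A] coeffs_carrier(2), symmetric])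
      also have "\<dots> = det ?A \<cdot>\<^sub>v coeffs_Suc g"
        using coeffs_carrier(2)[of g] by (intro eq_vecI) (auto simp: smult_scalar_prod_distrib)
      also have "inverse (det ?A) \<cdot>\<^sub>v \<dots> = coeffs_Suc g"
        using det by (simp add: smult_smult_assoc)
      finally have "g - l * poly_of_vec v \<in> I"
        using cong[OF g poly_of_vec_homogeneous] coeffs_poly_of_vec[OF v] by simp
      then show "\<exists>f\<in>homogeneous s. g - l * f \<in> I"
        using poly_of_vec_homogeneous by blast
    qed
  qed
  then show ?thesis
    unfolding det_transpose[OF mult_matrix_carrier] .
qed

text \<open>
  One form \<open>l\<close> has to work in all degrees. The sum of the variables does if any form does in
  degree \<open>s\<close>: its matrix is the incidence matrix, whose determinant divides that of every form.
\<close>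

theorem weak_Lefschetz_iff_det:
  assumes "0 \<le> s"
    and no_socle: "\<And>m. m \<notin> B \<Longrightarrow> int (mon_degree m) < s \<Longrightarrow> \<exists>i. unit_exp i + m \<notin> B"
  shows "weak_Lefschetz (quot_ring I) (quot_part I) \<longleftrightarrow> det incidence_matrix \<noteq> 0"
proof
  assume "weak_Lefschetz (quot_ring I) (quot_part I)"
  then obtain q where "q \<in> quot_part I 1"
    and q: "inj_on (\<lambda>p. q \<otimes>\<^bsub>quot_ring I\<^esub> p) (quot_part I s)
      \<or> (\<lambda>p. q \<otimes>\<^bsub>quot_ring I\<^esub> p) ` quot_part I s = quot_part I (s + 1)"
    unfolding weak_Lefschetz_def by blast
  then obtain l where l: "l \<in> homogeneous 1" and "q = cls l"
    by (auto simp: quot_part_def)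
  then have "det (mult_matrix l) \<noteq> 0"
    using q inj_on_quot_part image_quot_part[OF l] injective_iff_det[OF l] surjective_iff_det[OF l]
    by metis
  then show "det incidence_matrix \<noteq> 0"
    using det_mult_matrix[of l] by auto
next
  assume det: "det incidence_matrix \<noteq> 0"
  define l :: "'k poly3" where "l = (\<Sum>i\<in>UNIV. indet i)"
  have l: "l \<in> homogeneous 1"
    unfolding l_def by (intro sum_homogeneous indet_homogeneous)
  have "det (mult_matrix l) \<noteq> 0"
    using det unfolding l_def mult_matrix_sum_of_variables .
  then have inj: "\<forall>f\<in>homogeneous s. l * f \<in> I \<longrightarrow> f \<in> I"
    and surj: "\<forall>g\<in>homogeneous (s + 1). \<exists>f\<in>homogeneous s. g - l * f \<in> I"
    using injective_iff_det[OF l] surjective_iff_det[OF l] by blast+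
  show "weak_Lefschetz (quot_ring I) (quot_part I)"
    unfolding weak_Lefschetz_def
  proof (intro bexI allI)
    show "cls l \<in> quot_part I 1"
      using l by (simp add: quot_part_def)
    fix d
    show "inj_on (\<lambda>q. cls l \<otimes>\<^bsub>quot_ring I\<^esub> q) (quot_part I d)
        \<or> (\<lambda>q. cls l \<otimes>\<^bsub>quot_ring I\<^esub> q) ` quot_part I d = quot_part I (d + 1)"
    proof (cases "d \<le> s")
      case True
      then show ?thesis
        using injective_descends[OF no_socle inj] unfolding inj_on_quot_part by blast
    next
      case False
      then show ?thesis
        using surjective_ascends[OF surj \<open>0 \<le> s\<close>, of d] unfolding image_quot_part[OF l] by simp
    qed
  qed
qed

end

section \<open>Counting standard monomials\<close>

definition monomials :: "int \<Rightarrow> (3 \<Rightarrow>\<^sub>0 nat) set" where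
  "monomials d = {m. int (mon_degree m) = d}"

lemma finite_monomials [simp]: "finite (monomials d)"
  unfolding monomials_def by (rule finite_monomials_of_degree)

text \<open>
  The monomials of degree \<open>d + 1\<close> divisible by \<open>x\<close> correspond to those of degree \<open>d\<close>, and
  \<open>d + 2\<close> monomials do not involve \<open>x\<close>. The claim starts at \<open>d = -2\<close>, where both counts vanish,
  because shifts down to this degree occur when a generator has degree \<open>s + 2\<close>.
\<close>

lemma card_monomials_Suc:
  assumes "-2 \<le> d"
  shows "int (card (monomials (d + 1))) = int (card (monomials d)) + (d + 2)"
proof (cases "d = -2")
  case True
  then have "monomials (d + 1) = {}" "monomials d = {}" by (auto simp: monomials_def)
  then show ?thesis using True by simp
next
  case False
  define n where "n = nat (d + 1)"
  have n: "int n = d + 1" using False assms by (simp add: n_def)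
  let ?g = "\<lambda>j. Poly_Mapping.single 1 j + Poly_Mapping.single 2 (n - j) :: 3 \<Rightarrow>\<^sub>0 nat"
  have "monomials (d + 1) = (+) (unit_exp 0) ` monomials d \<union> ?g ` {..n}"
  proof (intro equalityI subsetI)
    fix m assume m: "m \<in> monomials (d + 1)"
    show "m \<in> (+) (unit_exp 0) ` monomials d \<union> ?g ` {..n}"
    proof (cases "Poly_Mapping.lookup m 0 = 0")
      case True
      have "mon_degree m = n" using m n by (simp add: monomials_def)
      with True have sum: "Poly_Mapping.lookup m 1 + Poly_Mapping.lookup m 2 = n"
        by (simp add: mon_degree_alt)
      then have "\<forall>i. Poly_Mapping.lookup m i = Poly_Mapping.lookup (?g (Poly_Mapping.lookup m 1)) i"
        unfolding all_three using True by (auto simp: lookup_add lookup_single when_def)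
      then have "m = ?g (Poly_Mapping.lookup m 1)" by (intro poly_mapping_eqI) blast
      moreover have "Poly_Mapping.lookup m 1 \<in> {..n}" using sum by simp
      ultimately show ?thesis by (intro UnI2 image_eqI)
    next
      case False
      then have "\<exists>k. m = unit_exp 0 + k"
        unfolding monomial_le_iff by (simp add: lookup_single when_def)
      then obtain k where "m = unit_exp 0 + k" ..
      moreover have "k \<in> monomials d"
        using m \<open>m = unit_exp 0 + k\<close> by (simp add: monomials_def)
      ultimately show ?thesis by (intro UnI1 image_eqI)
    qed
  next
    fix m assume "m \<in> (+) (unit_exp 0) ` monomials d \<union> ?g ` {..n}"
    then show "m \<in> monomials (d + 1)"
      using n by (auto simp: monomials_def)
  qed
  moreover have "(+) (unit_exp 0) ` monomials d \<inter> ?g ` {..n} = {}"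
  proof -
    have "unit_exp 0 + k \<noteq> ?g j" for k j
    proof
      assume "unit_exp 0 + k = ?g j"
      then have "Poly_Mapping.lookup (unit_exp 0 + k) 0 = Poly_Mapping.lookup (?g j) 0" by (rule arg_cong)
      then show False by (simp add: lookup_add lookup_single when_def)
    qed
    then show ?thesis by blast
  qed
  ultimately have "card (monomials (d + 1)) = card ((+) (unit_exp 0) ` monomials d) + card (?g ` {..n})"
    by (simp add: card_Un_disjoint)
  moreover have "card ((+) (unit_exp 0) ` monomials d) = card (monomials d)"
    by (intro card_image inj_onI) simp
  moreover have "card (?g ` {..n}) = n + 1"
  proof -
    have "Poly_Mapping.lookup (?g j) 1 = j" for j
      by (simp add: lookup_add lookup_single when_def)
    then have "inj_on ?g {..n}" by (rule inj_on_inverseI)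
    then show ?thesis by (simp add: card_image)
  qed
  ultimately show ?thesis using n by simp
qed

context monomial_ideal
begin

text \<open>
  In degrees where no monomial is a multiple of two generators, the monomials of \<open>B\<close> are counted
  without inclusion-exclusion: the multiples of \<open>g\<close> in degree \<open>d\<close> correspond to all monomials of
  degree \<open>d - deg g\<close>, and their number grows by \<open>s + 2 - deg g\<close> from \<open>d = s\<close> to \<open>d = s + 1\<close>.
\<close>

lemma card_standard_Suc:
  assumes "finite G" and B: "B = {m. \<exists>g\<in>G. \<exists>k. m = g + k}"
    and overlap: "\<And>g g' k k'. g \<in> G \<Longrightarrow> g' \<in> G \<Longrightarrow> g \<noteq> g' \<Longrightarrow> g + k = g' + k'
      \<Longrightarrow> s + 1 < int (mon_degree (g + k))"
    and degree: "\<And>g. g \<in> G \<Longrightarrow> int (mon_degree g) \<le> s + 2" and "-2 \<le> s"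
  shows "int (card (standard (s + 1)))
    = int (card (standard s)) + (s + 2) - (\<Sum>g\<in>G. s + 2 - int (mon_degree g))"
proof -
  let ?D = "\<lambda>g d. (+) g ` monomials (d - int (mon_degree g))"
  have count: "int (card (monomials d))
      = int (card (standard d)) + (\<Sum>g\<in>G. int (card (monomials (d - int (mon_degree g)))))"
    if d: "d \<le> s + 1" for d
  proof -
    have D: "?D g d = {m \<in> monomials d. \<exists>k. m = g + k}" for g
      by (auto simp: monomials_def)
    have B_iff: "m \<in> B \<longleftrightarrow> (\<exists>g\<in>G. \<exists>k. m = g + k)" for m
      using B by blast
    have "monomials d = standard d \<union> (\<Union>g\<in>G. ?D g d)"
      unfolding D by (auto simp: standard_def monomials_def B_iff)
    moreover have "standard d \<inter> (\<Union>g\<in>G. ?D g d) = {}"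
      unfolding D by (auto simp: standard_def B_iff)
    ultimately have "card (monomials d) = card (standard d) + card (\<Union>g\<in>G. ?D g d)"
      using \<open>finite G\<close> by (simp add: card_Un_disjoint)
    also have "card (\<Union>g\<in>G. ?D g d) = (\<Sum>g\<in>G. card (?D g d))"
    proof (rule card_UN_disjoint)
      show "\<forall>g\<in>G. \<forall>g'\<in>G. g \<noteq> g' \<longrightarrow> ?D g d \<inter> ?D g' d = {}"
      proof (intro ballI impI, rule ccontr)
        fix g g' assume g: "g \<in> G" "g' \<in> G" "g \<noteq> g'" and "?D g d \<inter> ?D g' d \<noteq> {}"
        then obtain m where "m \<in> monomials d" "\<exists>k. m = g + k" "\<exists>k. m = g' + k"
          unfolding D by blast
        then obtain k k' where m: "m \<in> monomials d" "m = g + k" "m = g' + k'" by blast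
        then have "s + 1 < int (mon_degree (g + k))"
          using overlap[OF g, of k k'] by (simp del: mon_degree_add)
        moreover have "int (mon_degree (g + k)) = d"
          using m by (simp add: monomials_def)
        ultimately show False using d by (simp del: mon_degree_add)
      qed
    qed (use \<open>finite G\<close> in auto)
    also have "\<dots> = (\<Sum>g\<in>G. card (monomials (d - int (mon_degree g))))"
      by (intro sum.cong refl card_image inj_onI) simp
    finally show ?thesis by simp
  qed
  have step: "int (card (monomials (s + 1 - int (mon_degree g))))
      = int (card (monomials (s - int (mon_degree g)))) + (s + 2 - int (mon_degree g))" if "g \<in> G" for g
    using card_monomials_Suc[of "s - int (mon_degree g)"] degree[OF that] by (simp add: algebra_simps)
  have "(\<Sum>g\<in>G. int (card (monomials (s + 1 - int (mon_degree g)))))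
      = (\<Sum>g\<in>G. int (card (monomials (s - int (mon_degree g))))) + (\<Sum>g\<in>G. s + 2 - int (mon_degree g))"
    unfolding sum.distrib[symmetric] by (intro sum.cong refl step)
  then show ?thesis
    using count[of s] count[of "s + 1"] card_monomials_Suc[OF \<open>-2 \<le> s\<close>] by linarith
qed

end


section \<open>Artinian ideals with one mixed generator\<close>

abbreviation xyz :: "nat \<Rightarrow> nat \<Rightarrow> nat \<Rightarrow> (3 \<Rightarrow>\<^sub>0 nat)" where
  "xyz i j k \<equiv> Poly_Mapping.single 0 i + Poly_Mapping.single 1 j + Poly_Mapping.single 2 k"

lemma lookup_xyz:
  "Poly_Mapping.lookup (xyz i j k) 0 = i"
  "Poly_Mapping.lookup (xyz i j k) 1 = j"
  "Poly_Mapping.lookup (xyz i j k) 2 = k"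
  by (simp_all add: lookup_add lookup_single when_def)

lemma multiple_of_xyz_iff:
  "(\<exists>n. m = xyz i j k + n) \<longleftrightarrow> i \<le> Poly_Mapping.lookup m 0 \<and> j \<le> Poly_Mapping.lookup m 1 \<and> k \<le> Poly_Mapping.lookup m 2"
  unfolding monomial_le_iff all_three lookup_xyz ..

lemma xyz_eq_iff: "xyz i j k = xyz i' j' k' \<longleftrightarrow> i = i' \<and> j = j' \<and> k = k'"
  by (metis lookup_xyz)

lemma indet_power: "indet i ^ n = (mon (Poly_Mapping.single i n) :: 'k::field poly3)"
  by (induction n) (simp_all add: indet_def mon_def mult_single single_add[symmetric])

text \<open>
  This is the absence of socle elements below degree \<open>s\<close>. If \<open>m = x^i y^j z^k\<close> is standard but
  none of its multiples by a variable is, then for exactly one variable this is due to the mixed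
  generator: not for two, as that generator would divide \<open>m\<close>, and not for none, as it divides
  \<open>x^(a-1) y^(b-1) z^(c-1)\<close>. Hence \<open>m\<close> is \<open>x^(\<alpha>-1) y^(b-1) z^(c-1)\<close> or one of its two analogues.
  Nonnegativity of \<open>A\<close>, \<open>B\<close>, \<open>C\<close> and \<open>M\<close> places these monomials in degree at least \<open>s\<close>.
\<close>

lemma low_degree_not_socle:
  fixes a b c \<alpha> \<beta> \<gamma> i j k :: nat and s :: int
  assumes "\<alpha> < a" "\<beta> < b" "\<gamma> < c"
    and sum: "int (a + b + c + \<alpha> + \<beta> + \<gamma>) = 3 * (s + 2)"
    and nonneg: "int a \<le> s + 2" "int b \<le> s + 2" "int c \<le> s + 2" "int (\<alpha> + \<beta> + \<gamma>) \<le> s + 2"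
    and standard: "i < a" "j < b" "k < c" "\<not> (\<alpha> \<le> i \<and> \<beta> \<le> j \<and> \<gamma> \<le> k)"
    and degree: "int (i + j + k) < s"
  shows "(Suc i < a \<and> \<not> (\<alpha> \<le> Suc i \<and> \<beta> \<le> j \<and> \<gamma> \<le> k))
    \<or> (Suc j < b \<and> \<not> (\<alpha> \<le> i \<and> \<beta> \<le> Suc j \<and> \<gamma> \<le> k))
    \<or> (Suc k < c \<and> \<not> (\<alpha> \<le> i \<and> \<beta> \<le> j \<and> \<gamma> \<le> Suc k))"
proof (rule ccontr)
  assume "\<not> ?thesis"
  then have "a \<le> Suc i \<or> (\<alpha> \<le> Suc i \<and> \<beta> \<le> j \<and> \<gamma> \<le> k)"
    and "b \<le> Suc j \<or> (\<alpha> \<le> i \<and> \<beta> \<le> Suc j \<and> \<gamma> \<le> k)"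
    and "c \<le> Suc k \<or> (\<alpha> \<le> i \<and> \<beta> \<le> j \<and> \<gamma> \<le> Suc k)"
    by auto
  with standard assms(1-3) consider
      "Suc i = \<alpha>" "Suc j = b" "Suc k = c" | "Suc i = a" "Suc j = \<beta>" "Suc k = c"
    | "Suc i = a" "Suc j = b" "Suc k = \<gamma>"
    by linarith
  then have "(int i = int \<alpha> - 1 \<and> int j = int b - 1 \<and> int k = int c - 1)
      \<or> (int i = int a - 1 \<and> int j = int \<beta> - 1 \<and> int k = int c - 1)
      \<or> (int i = int a - 1 \<and> int j = int b - 1 \<and> int k = int \<gamma> - 1)"
    by cases auto
  moreover have "0 \<le> int i" "0 \<le> int j" "0 \<le> int k" by simp_all
  ultimately show False
    using sum nonneg degree unfolding of_nat_add by (elim disjE conjE) simp_all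
qed

theorem proposition3p8:
  fixes a b c \<alpha> \<beta> \<gamma> :: nat
    and s A B C M :: int
    and I :: "'k::field poly3 set"
    and h :: nat
  assumes "infinite (UNIV :: 'k set)"
    and "I = Idl\<^bsub>poly3_ring\<^esub> {indet 0 ^ a, indet 1 ^ b, indet 2 ^ c, indet 0 ^ \<alpha> * indet 1 ^ \<beta> * indet 2 ^ \<gamma>}"
    and "\<alpha> < a" and "\<beta> < b" and "\<gamma> < c"
    and "\<not> (\<alpha> = 0 \<and> \<beta> = 0)" and "\<not> (\<alpha> = 0 \<and> \<gamma> = 0)" and "\<not> (\<beta> = 0 \<and> \<gamma> = 0)"
    and "[a + b + c + \<alpha> + \<beta> + \<gamma> = 0] (mod 3)"
    and "s = int (a + b + c + \<alpha> + \<beta> + \<gamma>) div 3 - 2"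
    and "A = s + 2 - int a" and "B = s + 2 - int b" and "C = s + 2 - int c"
    and "M = s + 2 - int (\<alpha> + \<beta> + \<gamma>)"
    and "0 \<le> M"
    and "0 \<le> A" and "A \<le> int (\<beta> + \<gamma>)"
    and "0 \<le> B" and "B \<le> int (\<alpha> + \<gamma>)"
    and "0 \<le> C" and "C \<le> int (\<alpha> + \<beta>)"
    and "h = hilbert_function I s"
  shows "\<exists>Z :: int mat.
      Z \<in> carrier_mat h h \<and>
      (weak_Lefschetz (quot_ring I) (quot_part I) \<longleftrightarrow> \<not> [det Z = 0] (mod int CHAR('k))) \<and>
      length (monomial_basis I s) = h \<and>
      length (monomial_basis I (s + 1)) = h \<and>
      (\<forall>i<h. \<forall>j<h. Z $$ (i, j) =
         (if monomial_basis I s ! i dvd monomial_basis I (s + 1) ! j then 1 else 0))"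
proof -
  define G where "G = {xyz a 0 0, xyz 0 b 0, xyz 0 0 c, xyz \<alpha> \<beta> \<gamma>}"
  define N where "N = {m. \<exists>g\<in>G. \<exists>k. m = g + k}"
  obtain q where "a + b + c + \<alpha> + \<beta> + \<gamma> = 3 * q"
    using assms(9) by (auto simp: cong_0_iff)
  then have sum: "int (a + b + c + \<alpha> + \<beta> + \<gamma>) = 3 * (s + 2)"
    unfolding assms(10) by simp
  have nonneg: "int a \<le> s + 2" "int b \<le> s + 2" "int c \<le> s + 2" "int (\<alpha> + \<beta> + \<gamma>) \<le> s + 2"
    using assms(11-20) by simp_all
  \<comment> \<open>Common multiples of two generators have degree at least \<open>s + 2\<close>: for \<open>x^a\<close> and \<open>y^b\<close> this says
    \<open>A + B \<le> s + 2 = A + B + C + M\<close>, for \<open>x^a\<close> and the mixed generator \<open>A \<le> \<beta> + \<gamma>\<close>.\<close>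
  have bounds: "s + 2 \<le> int (a + b)" "s + 2 \<le> int (a + c)" "s + 2 \<le> int (b + c)"
      "s + 2 \<le> int (a + \<beta> + \<gamma>)" "s + 2 \<le> int (\<alpha> + b + \<gamma>)" "s + 2 \<le> int (\<alpha> + \<beta> + c)"
    using sum nonneg assms(11-21) by simp_all
  have "0 \<le> s" using nonneg(4) assms(6-8) by linarith

  have "I = Idl\<^bsub>poly3_ring\<^esub> (mon ` G)"
    unfolding assms(2) G_def by (simp add: indet_power) (simp add: mon_def mult_single)
  then have I: "I = {f. Poly_Mapping.keys f \<subseteq> N}"
    unfolding N_def by (simp only: genideal_monomials)
  have N_up: "m + k \<in> N" if "m \<in> N" for m k
    using that unfolding N_def by (auto simp: add.assoc) (metis add.assoc)
  interpret monomial_ideal N I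
    by unfold_locales (fact N_up, fact I)
  have N_iff: "m \<in> N \<longleftrightarrow> a \<le> Poly_Mapping.lookup m 0 \<or> b \<le> Poly_Mapping.lookup m 1
      \<or> c \<le> Poly_Mapping.lookup m 2
      \<or> (\<alpha> \<le> Poly_Mapping.lookup m 0 \<and> \<beta> \<le> Poly_Mapping.lookup m 1 \<and> \<gamma> \<le> Poly_Mapping.lookup m 2)" for m
    unfolding N_def G_def by (simp only: mem_Collect_eq bex_simps multiple_of_xyz_iff) auto
  have "0 \<notin> N" using assms(3-6) by (auto simp: N_iff)
  then have h: "h = card (standard s)"
    using assms(22) hilbert_function_eq by simp

  have "int (card (standard (s + 1)))
      = int (card (standard s)) + (s + 2) - (\<Sum>g\<in>G. s + 2 - int (mon_degree g))"
  proof (rule card_standard_Suc[OF _ N_def])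
    fix g g' k k' assume g: "g \<in> G" "g' \<in> G" "g \<noteq> g'" and "g + k = g' + k'"
    define m where "m = g + k"
    let ?i = "Poly_Mapping.lookup m 0" and ?j = "Poly_Mapping.lookup m 1" and ?k = "Poly_Mapping.lookup m 2"
    have divisor: "(f = xyz a 0 0 \<and> a \<le> ?i) \<or> (f = xyz 0 b 0 \<and> b \<le> ?j) \<or> (f = xyz 0 0 c \<and> c \<le> ?k)
        \<or> (f = xyz \<alpha> \<beta> \<gamma> \<and> \<alpha> \<le> ?i \<and> \<beta> \<le> ?j \<and> \<gamma> \<le> ?k)"
      if "f \<in> G" and f: "\<exists>k. m = f + k" for f
    proof -
      from \<open>f \<in> G\<close> consider "f = xyz a 0 0" | "f = xyz 0 b 0" | "f = xyz 0 0 c" | "f = xyz \<alpha> \<beta> \<gamma>"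
        unfolding G_def by blast
      then show ?thesis
        using f by cases (simp_all only: multiple_of_xyz_iff simp_thms)
    qed
    have "\<exists>k. m = g + k" "\<exists>k. m = g' + k"
      using \<open>g + k = g' + k'\<close> m_def by blast+
    then have "(a \<le> ?i \<and> b \<le> ?j) \<or> (a \<le> ?i \<and> c \<le> ?k) \<or> (b \<le> ?j \<and> c \<le> ?k)
        \<or> (a \<le> ?i \<and> \<beta> \<le> ?j \<and> \<gamma> \<le> ?k) \<or> (\<alpha> \<le> ?i \<and> b \<le> ?j \<and> \<gamma> \<le> ?k)
        \<or> (\<alpha> \<le> ?i \<and> \<beta> \<le> ?j \<and> c \<le> ?k)"
      using divisor[OF g(1)] divisor[OF g(2)] g(3) by metis
    then have "s + 1 < int (?i + ?j + ?k)"
      using bounds by (elim disjE conjE) simp_all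
    then show "s + 1 < int (mon_degree (g + k))"
      unfolding m_def mon_degree_alt .
  next
    fix g assume "g \<in> G"
    then show "int (mon_degree g) \<le> s + 2"
      using nonneg by (auto simp: G_def)
  qed (use \<open>0 \<le> s\<close> in \<open>simp_all add: G_def\<close>)
  \<comment> \<open>The sum is \<open>A + B + C + M\<close>.\<close>
  also have "(\<Sum>g\<in>G. s + 2 - int (mon_degree g)) = s + 2"
  proof -
    have "xyz a 0 0 \<noteq> xyz 0 b 0" "xyz a 0 0 \<noteq> xyz 0 0 c" "xyz a 0 0 \<noteq> xyz \<alpha> \<beta> \<gamma>"
        "xyz 0 b 0 \<noteq> xyz 0 0 c" "xyz 0 b 0 \<noteq> xyz \<alpha> \<beta> \<gamma>" "xyz 0 0 c \<noteq> xyz \<alpha> \<beta> \<gamma>"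
      unfolding xyz_eq_iff using assms(3-5) by auto
    then have "(\<Sum>g\<in>G. s + 2 - int (mon_degree g)) = (s + 2 - int (mon_degree (xyz a 0 0)))
        + (s + 2 - int (mon_degree (xyz 0 b 0))) + (s + 2 - int (mon_degree (xyz 0 0 c)))
        + (s + 2 - int (mon_degree (xyz \<alpha> \<beta> \<gamma>)))"
      unfolding G_def by (simp del: single_zero add_0_left add_0_right mon_degree_add)
    then show ?thesis using sum by simp
  qed
  finally have h_Suc: "h = card (standard (s + 1))" using h by simp

  define ms where "ms = rev (sorted_list_of_set (standard s))"
  define ns where "ns = rev (sorted_list_of_set (standard (s + 1)))"
  interpret balanced_degree N I s h ms ns
    by unfold_locales (simp_all add: ms_def ns_def h [symmetric] h_Suc [symmetric])
  have basis: "monomial_basis I s = map mon ms" "monomial_basis I (s + 1) = map mon ns"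
    by (simp_all add: monomial_basis_def ms_def ns_def standard_def mon_in_I_iff)

  define Z :: "int mat" where
    "Z = mat h h (\<lambda>(i, j). if \<exists>k. ns ! j = ms ! i + k then 1 else 0)"
  have "incidence_matrix = map_mat of_int Z"
    unfolding incidence_matrix_def Z_def by (intro eq_matI) auto
  then have "det incidence_matrix = (of_int (det Z) :: 'k)"
    by (simp add: of_int_hom.hom_det)
  then have "det incidence_matrix \<noteq> 0 \<longleftrightarrow> \<not> [det Z = 0] (mod int CHAR('k))"
    by (simp add: of_int_eq_0_iff_char_dvd cong_0_iff)
  moreover have "weak_Lefschetz (quot_ring I) (quot_part I) \<longleftrightarrow> det incidence_matrix \<noteq> 0"
  proof (rule weak_Lefschetz_iff_det[OF \<open>0 \<le> s\<close>])
    fix m assume "m \<notin> N" and "int (mon_degree m) < s"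
    then show "\<exists>i. unit_exp i + m \<notin> N"
      using low_degree_not_socle[OF assms(3-5) sum nonneg, of "Poly_Mapping.lookup m 0"
          "Poly_Mapping.lookup m 1" "Poly_Mapping.lookup m 2"]
      unfolding N_iff mon_degree_alt
      by (auto simp: lookup_add lookup_single when_def not_le
          intro: exI[of _ 0] exI[of _ 1] exI[of _ 2])
  qed
  ultimately have "weak_Lefschetz (quot_ring I) (quot_part I) \<longleftrightarrow> \<not> [det Z = 0] (mod int CHAR('k))"
    by simp
  moreover have "Z $$ (i, j) = (if monomial_basis I s ! i dvd monomial_basis I (s + 1) ! j then 1 else 0)"
    if "i < h" "j < h" for i j
    using that ms(3) ns(3) by (simp add: Z_def basis mon_dvd_iff)
  ultimately show ?thesis
    using ms(3) ns(3) by (intro exI[of _ Z]) (simp add: Z_def basis)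
qed

end
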